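(* Let $X$ be a non-trivial complex Banach space. (i) Let $I=\mathbb{R}$ or $I=[0,\infty)$. Then $AAA(I:X)\cap Q\text{-}AAP(I:X)=AAP(I:X)$ and $[AAA(I:X)\setminus AAP(I:X)]\cap Q\text{-}AAP(I:X)=\emptyset$. (ii) $AA(\mathbb{R}:X)\cap Q\text{-}AAP(\mathbb{R}:X)=AP(\mathbb{R}:X)$.
   Context: $C_b(I:X)$ is the space of bounded continuous functions $I\to X$, and $C_0(I:X)$ is the space of those $f\in C_b(I:X)$ with $\lim_{|t|\to+\infty}\|f(t)\|=0$. $AP(I:X)$ (almost periodic functions): continuous $f:I\to X$ such that for each $\epsilon>0$ the set $\{\tau>0: \|f(t+\tau)-f(t)\|\le\epsilon\ \forall t\in I\}$ is relatively dense in $I$, i.e. there is $l>0$ such that any subinterval of $I$ of length $l$ meets this set. $AAP(I:X)$ (asymptotically almost periodic functions): $f\in C_b(I:X)$ such that for every $\epsilon>0$ there are $l>0$ and $M>0$ such that every subinterval of $I$ of length $l$ contains at least one number $\tau$ such that $\|f(t+\tau)-f(t)\|\le\epsilon$ whenever $|t|,|t+\tau|\ge M$ (with $t,t+\tau\in I$). Equivalently, $f=g+\phi$ with $g\in AP(I:X)$ and $\phi\in C_0(I:X)$. $AA(\mathbb{R}:X)$ (almost automorphic functions): continuous $f:\mathbb{R}\to X$ such that for every real sequence $(b_n)$ there exist a subsequence $(a_n)$ of $(b_n)$ and a map $g:\mathbb{R}\to X$ with $\lim_{n\to\infty}f(t+a_n)=g(t)$ and $\lim_{n\to\infty}g(t-a_n)=f(t)$,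 pointwise for $t\in\mathbb{R}$. $AAA(I:X)$ (asymptotically almost automorphic functions): bounded continuous $f:I\to X$ for which there exist $h\in AA(\mathbb{R}:X)$ and $q\in C_0(I:X)$ such that $f=h+q$ on $I$. $Q\text{-}AAP(I:X)$ (quasi-asymptotically almost periodic functions): bounded continuous $f:I\to X$ such that for each $\epsilon>0$ there exists a finite number $L(\epsilon)>0$ such that any interval $I'\subseteq I$ of length $L(\epsilon)$ contains at least one number $\tau\in I'$ for which there exists a finite number $M(\epsilon,\tau)>0$ with $\|f(t+\tau)-f(t)\|\le\epsilon$ for all $t\in I$ with $|t|\ge M(\epsilon,\tau)$.
   Formalization: In the definition of AP(ℝ:X), nonzero ε-periods τ of either sign are allowed instead of only τ>0 (Bohr's usual definition), since no set of positive numbers meets every interval of length l in ℝ and AP(ℝ:X) would otherwise be empty, making (ii) false. *)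

theory Defs
  imports "HOL-Analysis.Analysis"
begin

text \<open>
  Complex Banach spaces: a complete real normed space together with a complex scalar
  multiplication that extends the real one and for which the norm is homogeneous.
  The law \<open>scaleC 1 x = x\<close> follows from \<open>scaleR_scaleC\<close>.
\<close>

class complex_banach = banach +
  fixes scaleC :: "complex \<Rightarrow> 'a \<Rightarrow> 'a"
  assumes scaleR_scaleC: "scaleR r x = scaleC (complex_of_real r) x"
    and scaleC_add_right: "scaleC a (x + y) = scaleC a x + scaleC a y"
    and scaleC_add_left: "scaleC (a + b) x = scaleC a x + scaleC b x"
    and scaleC_scaleC: "scaleC a (scaleC b x) = scaleC (a * b) x"
    and norm_scaleC: "norm (scaleC a x) = cmod a * norm x"

instantiation complex :: complex_banach
begin

definition scaleC_complex :: "complex \<Rightarrow> complex \<Rightarrow> complex"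
  where "scaleC_complex a x = a * x"

instance
  by standard
    (simp_all add: scaleC_complex_def scaleR_conv_of_real algebra_simps norm_mult)

end

text \<open>
  A function \<open>I \<rightarrow> X\<close> on a set \<open>I\<close> of reals is represented by a total function of type
  \<open>real \<Rightarrow> 'a\<close>, of which only the values on \<open>I\<close> matter: for \<open>I = UNIV\<close> and \<open>I = {0..}\<close>,
  membership in each of the sets below depends on the restriction to \<open>I\<close> only
  (\<open>t + \<tau> \<in> I\<close> whenever \<open>t, \<tau> \<in> I\<close>). Hence equality of these sets amounts to
  equality of the corresponding sets of functions on \<open>I\<close>.
\<close>

text \<open>
  For \<open>l > 0\<close>: \<open>J\<close> is an interval (open, closed or half-open) of length \<open>l\<close> contained in \<open>I\<close>.
\<close>

definition subinterval_of_length :: "real set \<Rightarrow> real \<Rightarrow> real set \<Rightarrow> bool"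
  where "subinterval_of_length I l J \<longleftrightarrow>
    J \<subseteq> I \<and> (\<exists>a. {a<..<a + l} \<subseteq> J \<and> J \<subseteq> {a..a + l})"

definition C_b :: "real set \<Rightarrow> (real \<Rightarrow> 'a::real_normed_vector) set"
  where "C_b I = {f. continuous_on I f \<and> bounded (f ` I)}"

definition C_0 :: "real set \<Rightarrow> (real \<Rightarrow> 'a::real_normed_vector) set"
  where "C_0 I = {f \<in> C_b I. ((\<lambda>t. norm (f t)) \<longlongrightarrow> 0) (inf at_infinity (principal I))}"

text \<open>
  On \<open>I = {0..}\<close> the condition \<open>\<tau> \<noteq> 0\<close> says \<open>\<tau> > 0\<close>, as \<open>\<tau> \<in> J \<subseteq> I\<close>. On \<open>I = UNIV\<close>
  one must also admit negative \<open>\<tau>\<close>: no set of positive numbers meets the intervals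
  on the negative half-line. There \<open>\<tau>\<close> is an \<open>\<epsilon>\<close>-period iff \<open>- \<tau>\<close> is, and
  this is the usual definition of Bohr.
\<close>

definition AP :: "real set \<Rightarrow> (real \<Rightarrow> 'a::real_normed_vector) set"
  where "AP I = {f. continuous_on I f \<and>
    (\<forall>\<epsilon>>0. \<exists>l>0. \<forall>J. subinterval_of_length I l J \<longrightarrow>
      (\<exists>\<tau>\<in>J. \<tau> \<noteq> 0 \<and> (\<forall>t\<in>I. norm (f (t + \<tau>) - f t) \<le> \<epsilon>)))}"

definition AAP :: "real set \<Rightarrow> (real \<Rightarrow> 'a::real_normed_vector) set"
  where "AAP I = {f \<in> C_b I.
    (\<forall>\<epsilon>>0. \<exists>l>0. \<exists>M>0. \<forall>J. subinterval_of_length I l J \<longrightarrow>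
      (\<exists>\<tau>\<in>J. \<forall>t. t \<in> I \<and> t + \<tau> \<in> I \<and> \<bar>t\<bar> \<ge> M \<and> \<bar>t + \<tau>\<bar> \<ge> M \<longrightarrow>
        norm (f (t + \<tau>) - f t) \<le> \<epsilon>))}"

definition AA :: "(real \<Rightarrow> 'a::real_normed_vector) set"
  where "AA = {f. continuous_on UNIV f \<and>
    (\<forall>b :: nat \<Rightarrow> real. \<exists>r :: nat \<Rightarrow> nat. \<exists>g :: real \<Rightarrow> 'a. strict_mono r \<and>
      (\<forall>t. (\<lambda>n. f (t + b (r n))) \<longlonglongrightarrow> g t) \<and>
      (\<forall>t. (\<lambda>n. g (t - b (r n))) \<longlonglongrightarrow> f t))}"

definition AAA :: "real set \<Rightarrow> (real \<Rightarrow> 'a::real_normed_vector) set"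
  where "AAA I = {f \<in> C_b I. \<exists>h\<in>AA. \<exists>q\<in>C_0 I. \<forall>t\<in>I. f t = h t + q t}"

definition Q_AAP :: "real set \<Rightarrow> (real \<Rightarrow> 'a::real_normed_vector) set"
  where "Q_AAP I = {f \<in> C_b I.
    (\<forall>\<epsilon>>0. \<exists>L>0. \<forall>J. subinterval_of_length I L J \<longrightarrow>
      (\<exists>\<tau>\<in>J. \<exists>M>0. \<forall>t\<in>I. \<bar>t\<bar> \<ge> M \<longrightarrow> norm (f (t + \<tau>) - f t) \<le> \<epsilon>))}"

end

theory Submission
  imports Defs
begin

text \<open>
  If \<open>h\<close> is almost automorphic and \<open>h (t + \<tau>) - h t\<close> is small for all large \<open>t\<close>, then translating
  to infinity and back along a sequence \<open>a\<^sub>n \<longrightarrow> \<infinity>\<close> makes it small for every \<open>t\<close>. So the almost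
  automorphic part of a quasi-asymptotically almost periodic function is almost periodic.

  Conversely, an asymptotically almost periodic \<open>f\<close> splits as \<open>h + q\<close>. Put
  \<open>\<sigma> (k + 1) = \<sigma> k + \<tau> k\<close> with \<open>\<tau> k\<close> a large asymptotic \<open>2\<^sup>-\<^sup>k\<close>-period of \<open>f\<close>. Then
  \<open>f (t + \<sigma> k)\<close> converges to some \<open>g t\<close>, the translates \<open>g (t - \<sigma> k)\<close> converge uniformly on the
  whole line to some \<open>h t\<close>, and \<open>f - h\<close> vanishes at infinity. Every asymptotic \<open>\<epsilon>\<close>-period of
  \<open>f\<close> is an \<open>\<epsilon>\<close>-period of \<open>g\<close> and of \<open>h\<close>. Finally \<open>h\<close> is almost automorphic because
  the translates of an almost periodic function are relatively compact in the supremum norm.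
\<close>

section \<open>Subintervals and functions vanishing at infinity\<close>

lemma subinterval_of_lengthE:
  assumes "subinterval_of_length I l J"
  obtains a where "{a<..<a + l} \<subseteq> J" "J \<subseteq> I"
  using assms by (auto simp: subinterval_of_length_def)

lemma subinterval_of_length_greaterThanLessThan:
  assumes "{a<..<a + l} \<subseteq> I"
  shows "subinterval_of_length I l {a<..<a + l}"
  using assms unfolding subinterval_of_length_def by (intro conjI exI[of _ a]) auto

lemma C_0_bound:
  assumes "q \<in> C_0 I" "\<epsilon> > 0"
  obtains M where "M > 0" "\<And>t. t \<in> I \<Longrightarrow> \<bar>t\<bar> \<ge> M \<Longrightarrow> norm (q t) \<le> \<epsilon>"
proof -
  have "\<forall>\<^sub>F t in inf at_infinity (principal I). norm (q t) < \<epsilon>"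
    using assms by (auto simp: C_0_def dest!: order_tendstoD(2))
  then obtain M where M: "\<And>t. \<bar>t\<bar> \<ge> M \<Longrightarrow> t \<in> I \<Longrightarrow> norm (q t) < \<epsilon>"
    by (auto simp: eventually_inf_principal eventually_at_infinity)
  show thesis
    by (rule that[of "max M 1"]) (use M in \<open>auto intro: less_imp_le\<close>)
qed

lemma C_0I:
  assumes "q \<in> C_b I"
    and "\<And>\<epsilon>. \<epsilon> > 0 \<Longrightarrow> \<exists>M. \<forall>t\<in>I. \<bar>t\<bar> \<ge> M \<longrightarrow> norm (q t) \<le> \<epsilon>"
  shows "q \<in> C_0 I"
proof -
  have "((\<lambda>t. norm (q t)) \<longlongrightarrow> 0) (inf at_infinity (principal I))"
  proof (rule tendstoI)
    fix e :: real assume "e > 0"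
    then obtain M where "\<forall>t\<in>I. \<bar>t\<bar> \<ge> M \<longrightarrow> norm (q t) \<le> e / 2"
      using assms(2)[of "e / 2"] by auto
    with \<open>e > 0\<close> have "\<forall>t\<in>I. \<bar>t\<bar> \<ge> M \<longrightarrow> norm (q t) < e"
      by (auto intro: le_less_trans[of _ "e / 2"])
    then show "\<forall>\<^sub>F t in inf at_infinity (principal I). dist (norm (q t)) 0 < e"
      unfolding eventually_inf_principal eventually_at_infinity
      by (intro exI[of _ M]) simp
  qed
  with assms(1) show ?thesis by (simp add: C_0_def)
qed

lemma C_b_diff:
  assumes "f \<in> C_b I" "g \<in> C_b I"
  shows "(\<lambda>t. f t - g t) \<in> C_b I"
  using assms unfolding C_b_def
  by (auto intro: continuous_on_diff bounded_minus_comp)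

lemma C_b_mono: "f \<in> C_b I \<Longrightarrow> J \<subseteq> I \<Longrightarrow> f \<in> C_b J"
  unfolding C_b_def by (auto intro: continuous_on_subset bounded_subset)

lemma zero_in_C_0: "(\<lambda>_. 0) \<in> C_0 I"
  by (auto simp: C_0_def C_b_def image_constant_conv)

section \<open>Almost periodic functions on the line\<close>

text \<open>Periods near the negative axis come for free: replacing \<open>t\<close> by
  \<open>t - \<tau>\<close> shows that \<open>- \<tau>\<close> is a period together with
  \<open>\<tau>\<close>. An interval of length \<open>2 * l\<close> has either a right half that
  starts at a nonnegative point or a left half whose reflection does. The open intervals exclude the
  period 0.\<close>

lemma AP_UNIV_I:
  assumes cont: "continuous_on UNIV f"
    and per: "\<And>\<epsilon>. \<epsilon> > 0 \<Longrightarrow>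
      \<exists>l>0. \<forall>a\<ge>0. \<exists>\<tau>\<in>{a<..<a + l}. \<forall>t. norm (f (t + \<tau>) - f t) \<le> \<epsilon>"
  shows "f \<in> AP UNIV"
proof -
  have "\<exists>l>0. \<forall>J. subinterval_of_length UNIV l J \<longrightarrow>
      (\<exists>\<tau>\<in>J. \<tau> \<noteq> 0 \<and> (\<forall>t\<in>UNIV. norm (f (t + \<tau>) - f t) \<le> \<epsilon>))" if "\<epsilon> > 0" for \<epsilon>
  proof -
    obtain l where l: "l > 0"
      "\<And>a. a \<ge> 0 \<Longrightarrow> \<exists>\<tau>\<in>{a<..<a + l}. \<forall>t. norm (f (t + \<tau>) - f t) \<le> \<epsilon>"
      using per[OF \<open>\<epsilon> > 0\<close>] by blast
    have "\<exists>\<tau>\<in>J. \<tau> \<noteq> 0 \<and> (\<forall>t. norm (f (t + \<tau>) - f t) \<le> \<epsilon>)"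
      if J: "subinterval_of_length UNIV (2 * l) J" for J
    proof -
      obtain a where a: "{a<..<a + 2 * l} \<subseteq> J"
        using J by (rule subinterval_of_lengthE)
      show ?thesis
      proof (cases "a + l \<ge> 0")
        case True
        then obtain \<tau> where "\<tau> \<in> {a + l<..<a + l + l}" "\<forall>t. norm (f (t + \<tau>) - f t) \<le> \<epsilon>"
          using l(2) by blast
        with True a l(1) show ?thesis by (intro bexI[of _ \<tau>]) auto
      next
        case False
        then obtain \<tau> where \<tau>: "\<tau> \<in> {- (a + l)<..<- (a + l) + l}"
          "\<And>t. norm (f (t + \<tau>) - f t) \<le> \<epsilon>"
          using l(2)[of "- (a + l)"] by auto
        have "norm (f (t + - \<tau>) - f t) \<le> \<epsilon>" for t
          using \<tau>(2)[of "t - \<tau>"] by (simp add: norm_minus_commute)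
        with False a l(1) \<tau>(1) show ?thesis by (intro bexI[of _ "- \<tau>"]) auto
      qed
    qed
    with l(1) show ?thesis by (intro exI[of _ "2 * l"]) auto
  qed
  with cont show ?thesis by (simp add: AP_def)
qed

lemma AP_UNIV_E:
  assumes "f \<in> AP UNIV" "\<epsilon> > 0"
  obtains l where "l > 0" "\<And>a. \<exists>\<tau>\<in>{a<..<a + l}. \<forall>t. norm (f (t + \<tau>) - f t) \<le> \<epsilon>"
proof -
  obtain l where l: "l > 0" "\<And>J. subinterval_of_length UNIV l J \<Longrightarrow>
      \<exists>\<tau>\<in>J. \<tau> \<noteq> 0 \<and> (\<forall>t\<in>UNIV. norm (f (t + \<tau>) - f t) \<le> \<epsilon>)"
    using assms unfolding AP_def by blast
  have "\<exists>\<tau>\<in>{a<..<a + l}. \<forall>t. norm (f (t + \<tau>) - f t) \<le> \<epsilon>" for a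
    using l(2)[OF subinterval_of_length_greaterThanLessThan[of a l]] by blast
  with l(1) show thesis by (rule that)
qed

text \<open>An almost period moves any point into the compact interval \<open>{0..l}\<close>, where
  continuity bounds \<open>f\<close>; the shift costs at most 1.\<close>

lemma AP_UNIV_imp_C_b:
  assumes "f \<in> AP UNIV"
  shows "f \<in> C_b UNIV"
proof -
  have cont: "continuous_on UNIV f" using assms by (simp add: AP_def)
  obtain l where l: "l > 0" "\<And>a. \<exists>\<tau>\<in>{a<..<a + l}. \<forall>t. norm (f (t + \<tau>) - f t) \<le> 1"
    using AP_UNIV_E[OF assms, of 1] by auto
  have "bounded (f ` {0..l})"
    by (intro compact_imp_bounded compact_continuous_image continuous_on_subset[OF cont]) auto
  then obtain B where B: "\<And>t. t \<in> {0..l} \<Longrightarrow> norm (f t) \<le> B"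
    unfolding bounded_iff by blast
  have "norm (f t) \<le> B + 1" for t
  proof -
    obtain \<tau> where \<tau>: "\<tau> \<in> {- t<..<- t + l}" "norm (f (t + \<tau>) - f t) \<le> 1"
      using l(2) by blast
    have "norm (f t) \<le> norm (f (t + \<tau>)) + norm (f (t + \<tau>) - f t)"
      by (metis norm_minus_commute norm_triangle_sub)
    with \<tau> B[of "t + \<tau>"] show ?thesis by simp
  qed
  with cont show ?thesis by (auto simp: C_b_def bounded_iff)
qed

text \<open>A common shift moves \<open>x\<close> into \<open>{0..l}\<close>. The margin of 1 on
  both sides keeps the shifted neighbour \<open>y\<close> inside the compact interval, on which
  \<open>f\<close> is uniformly continuous.\<close>

lemma AP_UNIV_imp_uniformly_continuous:
  assumes "f \<in> AP UNIV"
  shows "uniformly_continuous_on UNIV f"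
  unfolding uniformly_continuous_on_def
proof (intro allI impI)
  fix e :: real assume e: "e > 0"
  have cont: "continuous_on UNIV f" using assms by (simp add: AP_def)
  obtain l where l: "l > 0" "\<And>a. \<exists>\<tau>\<in>{a<..<a + l}. \<forall>t. norm (f (t + \<tau>) - f t) \<le> e / 4"
    using AP_UNIV_E[OF assms, of "e / 4"] e by auto
  have "uniformly_continuous_on {-1..l + 1} f"
    by (intro compact_uniformly_continuous continuous_on_subset[OF cont]) auto
  then obtain d where d: "d > 0"
    "\<And>x y. x \<in> {-1..l + 1} \<Longrightarrow> y \<in> {-1..l + 1} \<Longrightarrow> dist y x < d \<Longrightarrow> dist (f y) (f x) < e / 2"
    using e unfolding uniformly_continuous_on_def by (metis half_gt_zero)
  have "dist (f y) (f x) < e" if "dist y x < min d 1" for x y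
  proof -
    obtain \<tau> where \<tau>: "\<tau> \<in> {- x<..<- x + l}" "\<And>t. norm (f (t + \<tau>) - f t) \<le> e / 4"
      using l(2) by blast
    have "dist (f (y + \<tau>)) (f (x + \<tau>)) < e / 2"
      by (rule d(2)) (use that \<tau>(1) in \<open>auto simp: dist_real_def\<close>)
    moreover have "dist (f y) (f x)
        \<le> dist (f (y + \<tau>)) (f y) + dist (f (y + \<tau>)) (f (x + \<tau>)) + dist (f (x + \<tau>)) (f x)"
      by metric
    ultimately show ?thesis using \<tau>(2)[of x] \<tau>(2)[of y] by (simp add: dist_norm)
  qed
  with d(1) show "\<exists>d>0. \<forall>x\<in>UNIV. \<forall>x'\<in>UNIV. dist x' x < d \<longrightarrow> dist (f x') (f x) < e"
    by (intro exI[of _ "min d 1"]) auto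
qed

text \<open>This is Bochner's criterion. The translates of \<open>f\<close> are points
  \<open>H s\<close> of the complete space of bounded continuous functions, and their range is
  totally bounded, since an almost period brings every \<open>s\<close> back to a compact interval.
  A subsequence therefore converges in the supremum norm, which is translation invariant, so the
  backward limit holds along the same subsequence.\<close>

lemma AP_UNIV_subset_AA: "(AP UNIV :: (real \<Rightarrow> 'a::banach) set) \<subseteq> AA"
proof
  fix f :: "real \<Rightarrow> 'a" assume f: "f \<in> AP UNIV"
  have cont: "continuous_on UNIV f" and bdd: "bounded (range f)"
    using AP_UNIV_imp_C_b[OF f] by (auto simp: C_b_def)
  define H where "H = (\<lambda>s. Bcontfun (\<lambda>t. f (t + s)))"
  have "(\<lambda>t. f (t + s)) \<in> bcontfun" for s
    unfolding bcontfun_def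
    by (auto intro!: continuous_on_compose2[OF cont] continuous_intros bounded_subset[OF bdd])
  then have H: "apply_bcontfun (H s) t = f (t + s)" for s t
    by (simp add: H_def Bcontfun_inverse)
  have contH: "continuous_on UNIV H"
  proof (rule uniformly_continuous_imp_continuous, unfold uniformly_continuous_on_def, safe)
    fix e :: real assume "e > 0"
    then obtain d where d: "d > 0" "\<And>x y. dist y x < d \<Longrightarrow> dist (f y) (f x) < e / 2"
      using AP_UNIV_imp_uniformly_continuous[OF f] unfolding uniformly_continuous_on_def
      by (metis UNIV_I half_gt_zero)
    have "dist (H y) (H x) < e" if "dist y x < d" for x y
    proof -
      have "dist (H y) (H x) \<le> e / 2"
        by (rule dist_bound) (use that d(2) in \<open>force simp: H dist_real_def intro: less_imp_le\<close>)
      with \<open>e > 0\<close> show ?thesis by simp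
    qed
    with d(1) show "\<exists>d>0. \<forall>x\<in>UNIV. \<forall>x'\<in>UNIV. dist x' x < d \<longrightarrow> dist (H x') (H x) < e" by blast
  qed
  have "\<exists>k. finite k \<and> closure (range H) \<subseteq> (\<Union>x\<in>k. ball x e)" if e: "e > 0" for e
  proof -
    obtain l where l: "l > 0" "\<And>a. \<exists>\<tau>\<in>{a<..<a + l}. \<forall>t. norm (f (t + \<tau>) - f t) \<le> e / 4"
      using AP_UNIV_E[OF f, of "e / 4"] e by auto
    have "compact (H ` {0..l})"
      by (intro compact_continuous_image continuous_on_subset[OF contH]) auto
    then obtain k where k: "finite k" "H ` {0..l} \<subseteq> (\<Union>x\<in>k. ball x (e / 4))"
      using e unfolding compact_eq_totally_bounded by (metis zero_less_divide_iff zero_less_numeral)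
    \<comment> \<open>A finite union of closed balls is closed, so it also covers the closure;
      radius \<open>e / 2\<close> leaves room to return to open balls of radius
      \<open>e\<close>.\<close>
    have "H s \<in> (\<Union>x\<in>k. cball x (e / 2))" for s
    proof -
      obtain \<tau> where \<tau>: "\<tau> \<in> {s - l<..<s - l + l}" "\<And>t. norm (f (t + \<tau>) - f t) \<le> e / 4"
        using l(2) by blast
      have "dist (H s) (H (s - \<tau>)) \<le> e / 4"
        by (rule dist_bound) (use \<tau>(2)[of "_ + (s - \<tau>)"] in \<open>simp add: H dist_norm\<close>)
      moreover have "H (s - \<tau>) \<in> (\<Union>x\<in>k. ball x (e / 4))" by (rule subsetD[OF k(2)]) (use \<tau>(1) in auto)
      then obtain x where "x \<in> k" "dist x (H (s - \<tau>)) < e / 4" by auto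
      moreover have "dist x (H s) \<le> dist x (H (s - \<tau>)) + dist (H s) (H (s - \<tau>))" by metric
      ultimately show ?thesis by (auto intro!: bexI[of _ x])
    qed
    then have "closure (range H) \<subseteq> (\<Union>x\<in>k. cball x (e / 2))"
      using k(1) by (intro closure_minimal closed_UN) auto
    also have "\<dots> \<subseteq> (\<Union>x\<in>k. ball x e)" using e by fastforce
    finally show ?thesis using k(1) by blast
  qed
  then have "compact (closure (range H))"
    unfolding compact_eq_totally_bounded by (simp add: complete_eq_closed)
  then have seq: "seq_compact (closure (range H))" by (rule compact_imp_seq_compact)
  have "\<exists>r g. strict_mono r \<and> (\<forall>t. (\<lambda>n. f (t + b (r n))) \<longlonglongrightarrow> g t) \<and>
      (\<forall>t. (\<lambda>n. g (t - b (r n))) \<longlonglongrightarrow> f t)" for b :: "nat \<Rightarrow> real"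
  proof -
    have "\<forall>n. H (b n) \<in> closure (range H)" by (simp add: closure_subset[THEN subsetD])
    then obtain G r where r: "strict_mono r" "((\<lambda>n. H (b n)) \<circ> r) \<longlonglongrightarrow> G"
      by (rule seq_compactE[OF seq])
    then have G: "(\<lambda>n. dist (H (b (r n))) G) \<longlonglongrightarrow> 0"
      by (simp add: o_def tendsto_dist_iff[THEN iffD1])
    have "(\<lambda>n. f (t + b (r n))) \<longlonglongrightarrow> apply_bcontfun G t" for t
      by (rule tendsto_dist_iff[THEN iffD2], rule tendsto_sandwich[OF _ _ tendsto_const G])
         (auto simp flip: H intro!: always_eventually dist_bounded)
    moreover have "(\<lambda>n. apply_bcontfun G (t - b (r n))) \<longlonglongrightarrow> f t" for t
    proof -
      \<comment> \<open>Evaluating \<open>H (b (r n))\<close> at \<open>t - b (r n)\<close> gives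
        exactly \<open>f t\<close>.\<close>
      have "dist (apply_bcontfun G (t - b (r n))) (f t) \<le> dist (H (b (r n))) G" for n
        using dist_bounded[of G "t - b (r n)" "H (b (r n))"] by (simp add: H dist_commute)
      then show ?thesis
        by (intro tendsto_dist_iff[THEN iffD2, OF tendsto_sandwich[OF _ _ tendsto_const G]]
              always_eventually) auto
    qed
    ultimately show ?thesis using r(1) by blast
  qed
  with cont show "f \<in> AA" by (simp add: AA_def)
qed

section \<open>Asymptotic periods of almost automorphic functions\<close>

lemma AA_asymptotic_period:
  assumes "h \<in> AA" "\<forall>\<^sub>F t in at_top. norm (h (t + \<tau>) - h t) \<le> \<epsilon>"
  shows "norm (h (t + \<tau>) - h t) \<le> \<epsilon>"
proof -
  \<comment> \<open>The sequence is \<open>b n = n\<close>. Every subsequence tends to infinity, so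
    each fixed \<open>t\<close> is eventually carried to where the assumed bound holds.\<close>
  obtain r g where r: "strict_mono r"
    and g: "\<And>t. (\<lambda>n. h (t + real (r n))) \<longlonglongrightarrow> g t"
    and h: "\<And>t. (\<lambda>n. g (t - real (r n))) \<longlonglongrightarrow> h t"
    using assms(1) unfolding AA_def by blast
  have "norm (g (t + \<tau>) - g t) \<le> \<epsilon>" for t
  proof (rule Lim_norm_ubound)
    show "(\<lambda>n. h (t + \<tau> + real (r n)) - h (t + real (r n))) \<longlonglongrightarrow> g (t + \<tau>) - g t"
      by (intro tendsto_diff g)
    have "filterlim (\<lambda>n. t + real (r n)) at_top sequentially"
      by (intro filterlim_tendsto_add_at_top[OF tendsto_const]
            filterlim_compose[OF filterlim_real_sequentially] filterlim_subseq r)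
    from filterlim_iff[THEN iffD1, OF this, rule_format, OF assms(2)]
    show "\<forall>\<^sub>F n in sequentially. norm (h (t + \<tau> + real (r n)) - h (t + real (r n))) \<le> \<epsilon>"
      by (simp add: add_ac)
  qed simp
  note g_period = this
  show ?thesis
  proof (rule Lim_norm_ubound)
    show "(\<lambda>n. g (t + \<tau> - real (r n)) - g (t - real (r n))) \<longlonglongrightarrow> h (t + \<tau>) - h t"
      by (intro tendsto_diff h)
    show "\<forall>\<^sub>F n in sequentially. norm (g (t + \<tau> - real (r n)) - g (t - real (r n))) \<le> \<epsilon>"
      using g_period[of "t - real (r _)"] by (simp add: algebra_simps)
  qed simp
qed

text \<open>Far out \<open>q\<close> is at most \<open>\<epsilon> / 3\<close>, so an asymptotic
  \<open>\<epsilon> / 3\<close>-period of \<open>f\<close> is an asymptotic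
  \<open>\<epsilon>\<close>-period of \<open>h\<close>, hence a true one. That the threshold
  \<open>M\<close> depends on the period is harmless, because almost automorphy removes it
  altogether. The right half-line suffices: only positive periods and large positive
  \<open>t\<close> are examined.\<close>

lemma AA_part_of_Q_AAP:
  assumes I: "{0..} \<subseteq> I"
    and f: "f \<in> Q_AAP I" and h: "h \<in> AA" and q: "q \<in> C_0 I"
    and eq: "\<And>t. t \<in> I \<Longrightarrow> f t = h t + q t"
  shows "h \<in> AP UNIV"
proof (rule AP_UNIV_I)
  show "continuous_on UNIV h" using h by (simp add: AA_def)
next
  fix \<epsilon> :: real assume \<epsilon>: "\<epsilon> > 0"
  obtain L where L: "L > 0" "\<And>J. subinterval_of_length I L J \<Longrightarrow>
      \<exists>\<tau>\<in>J. \<exists>M>0. \<forall>t\<in>I. \<bar>t\<bar> \<ge> M \<longrightarrow> norm (f (t + \<tau>) - f t) \<le> \<epsilon> / 3"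
    using f \<epsilon> unfolding Q_AAP_def by (auto dest!: spec[of _ "\<epsilon> / 3"])
  obtain N where N: "N > 0" "\<And>t. t \<in> I \<Longrightarrow> \<bar>t\<bar> \<ge> N \<Longrightarrow> norm (q t) \<le> \<epsilon> / 3"
    using C_0_bound[OF q, of "\<epsilon> / 3"] \<epsilon> by auto
  have "\<exists>\<tau>\<in>{a<..<a + L}. \<forall>t. norm (h (t + \<tau>) - h t) \<le> \<epsilon>" if a: "a \<ge> 0" for a
  proof -
    have "subinterval_of_length I L {a<..<a + L}"
      using a I by (intro subinterval_of_length_greaterThanLessThan) auto
    from L(2)[OF this] obtain \<tau> M where \<tau>: "\<tau> \<in> {a<..<a + L}"
      and M: "\<And>t. t \<in> I \<Longrightarrow> \<bar>t\<bar> \<ge> M \<Longrightarrow> norm (f (t + \<tau>) - f t) \<le> \<epsilon> / 3" by blast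
    have "norm (h (t + \<tau>) - h t) \<le> \<epsilon>" if t: "t \<ge> max M N" for t
    proof -
      have inI: "t \<in> I" "t + \<tau> \<in> I" using t N(1) \<tau> a I by auto
      have "h (t + \<tau>) - h t = (f (t + \<tau>) - f t) - q (t + \<tau>) + q t"
        using eq[OF inI(1)] eq[OF inI(2)] by simp
      also have "norm \<dots> \<le> norm (f (t + \<tau>) - f t) + norm (q (t + \<tau>)) + norm (q t)"
        by norm
      also have "\<dots> \<le> \<epsilon> / 3 + \<epsilon> / 3 + \<epsilon> / 3"
        using t \<tau> a N(1) by (intro add_mono M N(2) inI) auto
      finally show ?thesis by simp
    qed
    then have "\<forall>\<^sub>F t in at_top. norm (h (t + \<tau>) - h t) \<le> \<epsilon>"
      unfolding eventually_at_top_linorder by blast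
    with \<tau> show ?thesis using AA_asymptotic_period[OF h] by blast
  qed
  with L(1) show "\<exists>l>0. \<forall>a\<ge>0. \<exists>\<tau>\<in>{a<..<a + l}. \<forall>t. norm (h (t + \<tau>) - h t) \<le> \<epsilon>" by blast
qed

section \<open>Inclusions into and out of the asymptotically almost periodic functions\<close>

text \<open>The periods are those of \<open>h\<close>. Requiring both \<open>t\<close> and
  \<open>t + \<tau>\<close> to lie beyond \<open>M\<close> makes both values of \<open>q\<close>
  small, with \<open>M\<close> independent of the period.\<close>

lemma AP_plus_C_0_imp_AAP:
  assumes f: "f \<in> C_b I" and h: "h \<in> AP UNIV" and q: "q \<in> C_0 I"
    and eq: "\<And>t. t \<in> I \<Longrightarrow> f t = h t + q t"
  shows "f \<in> AAP I"
proof -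
  have "\<exists>l>0. \<exists>M>0. \<forall>J. subinterval_of_length I l J \<longrightarrow>
      (\<exists>\<tau>\<in>J. \<forall>t. t \<in> I \<and> t + \<tau> \<in> I \<and> \<bar>t\<bar> \<ge> M \<and> \<bar>t + \<tau>\<bar> \<ge> M \<longrightarrow>
        norm (f (t + \<tau>) - f t) \<le> \<epsilon>)" if \<epsilon>: "\<epsilon> > 0" for \<epsilon>
  proof -
    obtain l where l: "l > 0" "\<And>a. \<exists>\<tau>\<in>{a<..<a + l}. \<forall>t. norm (h (t + \<tau>) - h t) \<le> \<epsilon> / 3"
      using AP_UNIV_E[OF h, of "\<epsilon> / 3"] \<epsilon> by auto
    obtain M where M: "M > 0" "\<And>t. t \<in> I \<Longrightarrow> \<bar>t\<bar> \<ge> M \<Longrightarrow> norm (q t) \<le> \<epsilon> / 3"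
      using C_0_bound[OF q, of "\<epsilon> / 3"] \<epsilon> by auto
    have "\<exists>\<tau>\<in>J. \<forall>t. t \<in> I \<and> t + \<tau> \<in> I \<and> \<bar>t\<bar> \<ge> M \<and> \<bar>t + \<tau>\<bar> \<ge> M \<longrightarrow>
        norm (f (t + \<tau>) - f t) \<le> \<epsilon>" if J: "subinterval_of_length I l J" for J
    proof -
      obtain a where "{a<..<a + l} \<subseteq> J" using J by (rule subinterval_of_lengthE)
      with l(2)[of a] obtain \<tau> where \<tau>: "\<tau> \<in> J" "\<And>t. norm (h (t + \<tau>) - h t) \<le> \<epsilon> / 3"
        by blast
      have "norm (f (t + \<tau>) - f t) \<le> \<epsilon>"
        if t: "t \<in> I" "t + \<tau> \<in> I" "\<bar>t\<bar> \<ge> M" "\<bar>t + \<tau>\<bar> \<ge> M" for t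
      proof -
        have "f (t + \<tau>) - f t = (h (t + \<tau>) - h t) + q (t + \<tau>) - q t"
          using eq[OF t(1)] eq[OF t(2)] by simp
        also have "norm \<dots> \<le> norm (h (t + \<tau>) - h t) + norm (q (t + \<tau>)) + norm (q t)"
          by norm
        also have "\<dots> \<le> \<epsilon> / 3 + \<epsilon> / 3 + \<epsilon> / 3"
          using t by (intro add_mono M(2) \<tau>(2)) auto
        finally show ?thesis by simp
      qed
      with \<tau>(1) show ?thesis by blast
    qed
    with l(1) M(1) show ?thesis by blast
  qed
  with f show ?thesis by (simp add: AAP_def)
qed

text \<open>Once the period is fixed, the threshold \<open>M + \<bar>\<tau>\<bar>\<close> forces
  both \<open>t\<close> and \<open>t + \<tau>\<close> beyond \<open>M\<close>. Both choices of
  \<open>I\<close> are closed under addition, so \<open>t + \<tau>\<close> stays in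
  \<open>I\<close>.\<close>

lemma AAP_subset_Q_AAP:
  assumes I: "I = UNIV \<or> I = {0..}"
  shows "AAP I \<subseteq> Q_AAP I"
proof
  fix f :: "real \<Rightarrow> 'a" assume f: "f \<in> AAP I"
  have "\<exists>L>0. \<forall>J. subinterval_of_length I L J \<longrightarrow>
      (\<exists>\<tau>\<in>J. \<exists>M>0. \<forall>t\<in>I. \<bar>t\<bar> \<ge> M \<longrightarrow> norm (f (t + \<tau>) - f t) \<le> \<epsilon>)" if \<epsilon>: "\<epsilon> > 0" for \<epsilon>
  proof -
    obtain l M where l: "l > 0" "M > 0"
      and *: "\<And>J. subinterval_of_length I l J \<Longrightarrow>
        \<exists>\<tau>\<in>J. \<forall>t. t \<in> I \<and> t + \<tau> \<in> I \<and> \<bar>t\<bar> \<ge> M \<and> \<bar>t + \<tau>\<bar> \<ge> M \<longrightarrow> norm (f (t + \<tau>) - f t) \<le> \<epsilon>"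
      using f \<epsilon> unfolding AAP_def by blast
    have "\<exists>\<tau>\<in>J. \<exists>M>0. \<forall>t\<in>I. \<bar>t\<bar> \<ge> M \<longrightarrow> norm (f (t + \<tau>) - f t) \<le> \<epsilon>"
      if J: "subinterval_of_length I l J" for J
    proof -
      obtain \<tau> where \<tau>: "\<tau> \<in> J" "\<And>t. t \<in> I \<Longrightarrow> t + \<tau> \<in> I \<Longrightarrow> \<bar>t\<bar> \<ge> M \<Longrightarrow> \<bar>t + \<tau>\<bar> \<ge> M \<Longrightarrow>
          norm (f (t + \<tau>) - f t) \<le> \<epsilon>" using *[OF J] by blast
      have "\<tau> \<in> I" using \<tau>(1) J by (auto elim: subinterval_of_lengthE)
      with I have "t + \<tau> \<in> I" if "t \<in> I" for t using that by auto
      then have "\<forall>t\<in>I. \<bar>t\<bar> \<ge> M + \<bar>\<tau>\<bar> \<longrightarrow> norm (f (t + \<tau>) - f t) \<le> \<epsilon>"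
        by (intro ballI impI \<tau>(2)) auto
      with \<tau>(1) l(2) show ?thesis by (intro bexI[of _ \<tau>] exI[of _ "M + \<bar>\<tau>\<bar>"]) auto
    qed
    with l(1) show ?thesis by blast
  qed
  with f show "f \<in> Q_AAP I" by (simp add: AAP_def Q_AAP_def)
qed

section \<open>Decomposition of asymptotically almost periodic functions\<close>

text \<open>Serves both the translates to the right, which define \<open>g\<close>, and those back
  to the left, which define \<open>h\<close>. The offset \<open>K\<close> is there because the
  former are controlled at \<open>t\<close> only from an index depending on
  \<open>t\<close>.\<close>

lemma geometric_Cauchy_limit:
  fixes u :: "nat \<Rightarrow> 'a::banach"
  assumes "\<And>k m. K \<le> k \<Longrightarrow> k \<le> m \<Longrightarrow> norm (u m - u k) \<le> C * (1 / 2) ^ k"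
  shows "u \<longlonglongrightarrow> lim u"
    and "K \<le> k \<Longrightarrow> norm (lim u - u k) \<le> C * (1 / 2) ^ k"
proof -
  have "Cauchy u"
  proof (rule metric_CauchyI)
    fix e :: real assume e: "e > 0"
    have "(\<lambda>k. C * (1 / 2) ^ k) \<longlonglongrightarrow> C * 0" by (intro tendsto_intros) auto
    then have "\<forall>\<^sub>F k in sequentially. C * (1 / 2) ^ k < e / 2"
      using e by (intro order_tendstoD(2)) auto
    then obtain k where k: "k \<ge> K" "C * (1 / 2) ^ k < e / 2"
      unfolding eventually_sequentially by (metis linorder_linear)
    have "dist (u m) (u n) < e" if "m \<ge> k" "n \<ge> k" for m n
    proof -
      have "dist (u m) (u k) < e / 2" "dist (u n) (u k) < e / 2"
        using assms[OF k(1) that(1)] assms[OF k(1) that(2)] k(2) by (auto simp: dist_norm)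
      then show ?thesis by metric
    qed
    then show "\<exists>M. \<forall>m\<ge>M. \<forall>n\<ge>M. dist (u m) (u n) < e" by blast
  qed
  then show lim: "u \<longlonglongrightarrow> lim u"
    by (simp add: Cauchy_convergent_iff convergent_LIMSEQ_iff)
  show "norm (lim u - u k) \<le> C * (1 / 2) ^ k" if "K \<le> k"
    by (rule Lim_norm_ubound[OF _ tendsto_diff[OF lim tendsto_const]])
       (use assms[OF that] in \<open>auto simp: eventually_sequentially\<close>)
qed

text \<open>The limits \<open>g\<close> and \<open>h\<close> depend only on values of
  \<open>f\<close> at large positive arguments, so both choices of \<open>I\<close> are treated
  together. The left half-line matters only in the last estimate.\<close>

lemma AAP_decomposition:
  fixes f :: "real \<Rightarrow> 'a::banach"
  assumes I: "I = UNIV \<or> I = {0..}" and f: "f \<in> AAP I"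
  obtains h q where "h \<in> AP UNIV" "q \<in> C_0 I" "\<And>t. t \<in> I \<Longrightarrow> f t = h t + q t"
proof -
  have fC: "f \<in> C_b I" using f by (simp add: AAP_def)
  have contf: "continuous_on {0..} f"
    using fC I by (auto simp: C_b_def intro: continuous_on_subset)
  have per: "\<exists>l M. l > 0 \<and> M > 0 \<and> (\<forall>a\<ge>0. \<exists>\<tau>\<in>{a<..<a + l}. \<forall>t. t \<in> I \<and> t + \<tau> \<in> I \<and>
      \<bar>t\<bar> \<ge> M \<and> \<bar>t + \<tau>\<bar> \<ge> M \<longrightarrow> norm (f (t + \<tau>) - f t) \<le> \<epsilon>)" if "\<epsilon> > 0" for \<epsilon>
  proof -
    obtain l M where l: "l > 0" "M > 0"
      and *: "\<And>J. subinterval_of_length I l J \<Longrightarrow>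
        \<exists>\<tau>\<in>J. \<forall>t. t \<in> I \<and> t + \<tau> \<in> I \<and> \<bar>t\<bar> \<ge> M \<and> \<bar>t + \<tau>\<bar> \<ge> M \<longrightarrow> norm (f (t + \<tau>) - f t) \<le> \<epsilon>"
      using f \<open>\<epsilon> > 0\<close> unfolding AAP_def by blast
    have "subinterval_of_length I l {a<..<a + l}" if "a \<ge> 0" for a
      using that I by (intro subinterval_of_length_greaterThanLessThan) auto
    then show ?thesis using l by (intro exI[of _ l] exI[of _ M] conjI allI impI *) auto
  qed
  have "\<exists>M>0. \<forall>a\<ge>0. \<exists>\<tau>>a. \<forall>t\<ge>M. norm (f (t + \<tau>) - f t) \<le> (1 / 2) ^ k" for k :: nat
  proof -
    obtain l M where M: "M > 0" and *: "\<And>a. a \<ge> 0 \<Longrightarrow> \<exists>\<tau>\<in>{a<..<a + l}. \<forall>t. t \<in> I \<and>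
      t + \<tau> \<in> I \<and> \<bar>t\<bar> \<ge> M \<and> \<bar>t + \<tau>\<bar> \<ge> M \<longrightarrow> norm (f (t + \<tau>) - f t) \<le> (1 / 2) ^ k"
      using per[of "(1 / 2) ^ k"] by auto
    have "\<exists>\<tau>>a. \<forall>t\<ge>M. norm (f (t + \<tau>) - f t) \<le> (1 / 2) ^ k" if "a \<ge> 0" for a
    proof -
      obtain \<tau> where "\<tau> > a" "\<And>t. t \<in> I \<Longrightarrow> t + \<tau> \<in> I \<Longrightarrow> \<bar>t\<bar> \<ge> M \<Longrightarrow> \<bar>t + \<tau>\<bar> \<ge> M \<Longrightarrow>
          norm (f (t + \<tau>) - f t) \<le> (1 / 2) ^ k"
        using *[OF \<open>a \<ge> 0\<close>] by (meson greaterThanLessThan_iff)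
      with M \<open>a \<ge> 0\<close> I show ?thesis by (intro exI[of _ \<tau>]) auto
    qed
    with M show ?thesis by blast
  qed
  then obtain M where M: "\<And>k :: nat. M k > 0" and
    M': "\<And>k a. a \<ge> 0 \<Longrightarrow> \<exists>\<tau>>a. \<forall>t\<ge>M k. norm (f (t + \<tau>) - f t) \<le> (1 / 2) ^ k"
    by metis
  \<comment> \<open>This size makes \<open>\<sigma> k\<close> at least \<open>M k + real k\<close>.
    Hence for \<open>t\<close> above \<open>- real k\<close> the point \<open>t + \<sigma> k\<close>
    lies where \<open>\<tau> k\<close> acts as a period.\<close>
  have "\<exists>\<tau>>M (Suc k) + real (Suc k). \<forall>t\<ge>M k. norm (f (t + \<tau>) - f t) \<le> (1 / 2) ^ k" for k
    using M[of "Suc k"] by (intro M') auto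
  then obtain \<tau> where \<tau>: "\<And>k. \<tau> k > M (Suc k) + real (Suc k)"
    and \<tau>_period: "\<And>k t. t \<ge> M k \<Longrightarrow> norm (f (t + \<tau> k) - f t) \<le> (1 / 2) ^ k"
    by metis
  \<comment> \<open>The initial value \<open>M 0\<close> secures the lower bound on
    \<open>\<sigma> k\<close> already at \<open>k = 0\<close>.\<close>
  define \<sigma> where "\<sigma> = (\<lambda>k. M 0 + (\<Sum>i<k. \<tau> i))"
  have \<sigma>_Suc: "\<sigma> (Suc k) = \<sigma> k + \<tau> k" for k by (simp add: \<sigma>_def)
  have \<sigma>: "\<sigma> k \<ge> M k + real k" for k
  proof (cases k)
    case 0 then show ?thesis by (simp add: \<sigma>_def)
  next
    case (Suc j)
    have "\<tau> i \<ge> 0" for i using \<tau>[of i] M[of "Suc i"] by simp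
    then have "\<sigma> j \<ge> 0" unfolding \<sigma>_def using M[of 0] by (simp add: sum_nonneg add_nonneg_nonneg)
    then show ?thesis using \<sigma>_Suc[of j] \<tau>[of j] Suc by simp
  qed
  have \<sigma>_lim: "filterlim \<sigma> at_top sequentially"
    by (rule filterlim_at_top_mono[OF filterlim_real_sequentially])
       (use \<sigma> M in \<open>auto intro!: always_eventually add_increasing simp: less_imp_le
          intro: order_trans[OF _ \<sigma>]\<close>)
  have shift: "norm (f (t + \<sigma> m) - f (t + \<sigma> k)) \<le> 2 * (1 / 2) ^ k"
    if "k \<le> m" "t \<ge> - real k" for t k m
  proof -
    \<comment> \<open>The right-hand side is the exact sum of \<open>(1 / 2) ^ i\<close> over
      \<open>k \<le> i < m\<close>; the subtracted term lets the induction close.\<close>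
    have "norm (f (t + \<sigma> m) - f (t + \<sigma> k)) \<le> 2 * (1 / 2) ^ k - 2 * (1 / 2) ^ m"
      using that(1)
    proof (induction m rule: dec_induct)
      case (step m)
      have "t + \<sigma> m \<ge> M m" using \<sigma>[of m] that(2) step(1) by simp
      then have "norm (f (t + \<sigma> (Suc m)) - f (t + \<sigma> m)) \<le> (1 / 2) ^ m"
        using \<tau>_period[of m "t + \<sigma> m"] by (simp add: \<sigma>_Suc add.assoc)
      then have "norm (f (t + \<sigma> (Suc m)) - f (t + \<sigma> k))
          \<le> (1 / 2) ^ m + (2 * (1 / 2) ^ k - 2 * (1 / 2) ^ m)"
        using step.IH by norm
      then show ?case by simp
    qed simp
    moreover have "(1 / 2 :: real) ^ m \<ge> 0" by simp
    ultimately show ?thesis by linarith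
  qed
  define g where "g t = lim (\<lambda>m. f (t + \<sigma> m))" for t
  have ex_nat: "\<exists>k. t \<ge> - real k" for t
    using real_arch_simple[of "- t"] by (auto simp: minus_le_iff)
  have g_lim: "(\<lambda>m. f (t + \<sigma> m)) \<longlonglongrightarrow> g t" for t
  proof -
    obtain K where "t \<ge> - real K" using ex_nat by blast
    then show ?thesis
      unfolding g_def by (intro geometric_Cauchy_limit(1)[of K _ 2] shift) auto
  qed
  have g_bound: "norm (g t - f (t + \<sigma> k)) \<le> 2 * (1 / 2) ^ k" if "t \<ge> - real k" for t k
    unfolding g_def by (rule geometric_Cauchy_limit(2)[of k]) (use that in \<open>auto intro!: shift\<close>)
  have half_lim: "(\<lambda>k. 2 * (1 / 2) ^ k :: real) \<longlonglongrightarrow> 0"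
    by (auto intro!: tendsto_mult_right_zero LIMSEQ_realpow_zero)
  have contg: "continuous_on UNIV g"
  proof -
    \<comment> \<open>Convergence to \<open>g\<close> is uniform only on half-lines bounded below;
      these are open and cover the line, which is enough for continuity.\<close>
    have "continuous_on {- real K<..} g" for K
    proof (rule uniform_limit_theorem)
      show "\<forall>\<^sub>F k in sequentially. continuous_on {- real K<..} (\<lambda>t. f (t + \<sigma> k))"
        using eventually_ge_at_top[of K]
      proof eventually_elim
        case (elim k)
        then show ?case
          using \<sigma>[of k] M[of k]
          by (intro continuous_on_compose2[OF contf] continuous_intros) auto
      qed
      show "uniform_limit {- real K<..} (\<lambda>k t. f (t + \<sigma> k)) g sequentially"
      proof (rule uniform_limitI)
        fix e :: real assume "e > 0"
        then have "\<forall>\<^sub>F k in sequentially. 2 * (1 / 2) ^ k < e"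
          by (rule order_tendstoD(2)[OF half_lim])
        then show "\<forall>\<^sub>F k in sequentially. \<forall>t\<in>{- real K<..}. dist (f (t + \<sigma> k)) (g t) < e"
          using eventually_ge_at_top[of K]
        proof eventually_elim
          case (elim k)
          show ?case
          proof
            fix t assume "t \<in> {- real K<..}"
            then have "t \<ge> - real k" using elim(2) by simp
            from g_bound[OF this] elim(1) show "dist (f (t + \<sigma> k)) (g t) < e"
              by (simp add: dist_norm norm_minus_commute)
          qed
        qed
      qed
    qed simp
    then have "continuous_on (\<Union>K. {- real K<..}) g"
      by (intro continuous_on_open_UN) auto
    moreover have "(\<Union>K. {- real K<..}) = UNIV"
      using reals_Archimedean2[of "- _"] by (auto simp: minus_less_iff)
    ultimately show ?thesis by simp
  qed
  \<comment> \<open>No lower bound on \<open>t\<close> is required here: \<open>shift\<close> is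
    applied at \<open>t - \<sigma> m - \<sigma> k + \<sigma> n\<close>, which is nonnegative for
    large \<open>n\<close>. This is what makes the limit \<open>h\<close> uniform on the whole
    line.\<close>
  have g_shift: "norm (g (t - \<sigma> m) - g (t - \<sigma> k)) \<le> 2 * (1 / 2) ^ k" if "k \<le> m" for t k m
  proof (rule Lim_norm_ubound)
    show "(\<lambda>n. f (t - \<sigma> m + \<sigma> n) - f (t - \<sigma> k + \<sigma> n)) \<longlonglongrightarrow> g (t - \<sigma> m) - g (t - \<sigma> k)"
      by (intro tendsto_diff g_lim)
    show "\<forall>\<^sub>F n in sequentially. norm (f (t - \<sigma> m + \<sigma> n) - f (t - \<sigma> k + \<sigma> n)) \<le> 2 * (1 / 2) ^ k"
      using filterlim_at_top[THEN iffD1, OF \<sigma>_lim, rule_format, of "\<sigma> m + \<sigma> k - t"]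
    proof eventually_elim
      case (elim n)
      then show ?case
        using shift[OF that, of "t - \<sigma> m - \<sigma> k + \<sigma> n"]
        by (simp add: norm_minus_commute algebra_simps)
    qed
  qed simp
  define h where "h t = lim (\<lambda>k. g (t - \<sigma> k))" for t
  have h_lim: "(\<lambda>k. g (t - \<sigma> k)) \<longlonglongrightarrow> h t" for t
    unfolding h_def by (rule geometric_Cauchy_limit(1)[of 0 _ 2]) (rule g_shift)
  have h_bound: "norm (h t - g (t - \<sigma> k)) \<le> 2 * (1 / 2) ^ k" for t k
    unfolding h_def by (rule geometric_Cauchy_limit(2)[of 0]) (auto intro: g_shift)
  have conth: "continuous_on UNIV h"
  proof (rule uniform_limit_theorem)
    show "\<forall>\<^sub>F k in sequentially. continuous_on UNIV (\<lambda>t. g (t - \<sigma> k))"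
      by (intro always_eventually allI continuous_on_compose2[OF contg] continuous_intros) auto
    show "uniform_limit UNIV (\<lambda>k t. g (t - \<sigma> k)) h sequentially"
    proof (rule uniform_limitI)
      fix e :: real assume "e > 0"
      then have "\<forall>\<^sub>F k in sequentially. 2 * (1 / 2) ^ k < e"
        by (rule order_tendstoD(2)[OF half_lim])
      then show "\<forall>\<^sub>F k in sequentially. \<forall>t\<in>UNIV. dist (g (t - \<sigma> k)) (h t) < e"
      proof eventually_elim
        case (elim k)
        then show ?case
          using h_bound[of _ k] by (auto simp: dist_norm norm_minus_commute intro: le_less_trans)
      qed
    qed
  qed simp
  have h_period: "norm (h (t + p) - h t) \<le> \<epsilon>"
    if p: "\<And>t. t \<ge> N \<Longrightarrow> norm (f (t + p) - f t) \<le> \<epsilon>" for p N \<epsilon> t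
  proof -
    have g_period: "norm (g (t + p) - g t) \<le> \<epsilon>" for t
    proof (rule Lim_norm_ubound)
      show "(\<lambda>m. f (t + p + \<sigma> m) - f (t + \<sigma> m)) \<longlonglongrightarrow> g (t + p) - g t"
        by (intro tendsto_diff g_lim)
      show "\<forall>\<^sub>F m in sequentially. norm (f (t + p + \<sigma> m) - f (t + \<sigma> m)) \<le> \<epsilon>"
        using filterlim_at_top[THEN iffD1, OF \<sigma>_lim, rule_format, of "N - t"]
      proof eventually_elim
        case (elim m)
        then show ?case using p[of "t + \<sigma> m"] by (simp add: add_ac)
      qed
    qed simp
    show ?thesis
    proof (rule Lim_norm_ubound)
      show "(\<lambda>k. g (t + p - \<sigma> k) - g (t - \<sigma> k)) \<longlonglongrightarrow> h (t + p) - h t"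
        by (intro tendsto_diff h_lim)
      show "\<forall>\<^sub>F k in sequentially. norm (g (t + p - \<sigma> k) - g (t - \<sigma> k)) \<le> \<epsilon>"
        using g_period[of "t - \<sigma> _"] by (simp add: algebra_simps)
    qed simp
  qed
  \<comment> \<open>The same \<open>p\<close> must serve \<open>f\<close> and \<open>h\<close> at
    once, so that \<open>f - h\<close> at \<open>t\<close> can be compared with \<open>f - h\<close>
    at \<open>t + p\<close>.\<close>
  have common_period: "\<exists>l N. l > 0 \<and> N > 0 \<and> (\<forall>a\<ge>0. \<exists>p\<in>{a<..<a + l}.
      (\<forall>t. norm (h (t + p) - h t) \<le> \<epsilon>) \<and>
      (\<forall>t. t \<in> I \<and> t + p \<in> I \<and> \<bar>t\<bar> \<ge> N \<and> \<bar>t + p\<bar> \<ge> N \<longrightarrow> norm (f (t + p) - f t) \<le> \<epsilon>))"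
    if \<epsilon>: "\<epsilon> > 0" for \<epsilon>
  proof -
    obtain l N where l: "l > 0" "N > 0" and *: "\<And>a. a \<ge> 0 \<Longrightarrow> \<exists>p\<in>{a<..<a + l}. \<forall>t. t \<in> I \<and>
      t + p \<in> I \<and> \<bar>t\<bar> \<ge> N \<and> \<bar>t + p\<bar> \<ge> N \<longrightarrow> norm (f (t + p) - f t) \<le> \<epsilon>"
      using per[OF \<epsilon>] by blast
    have "\<exists>p\<in>{a<..<a + l}. (\<forall>t. norm (h (t + p) - h t) \<le> \<epsilon>) \<and>
      (\<forall>t. t \<in> I \<and> t + p \<in> I \<and> \<bar>t\<bar> \<ge> N \<and> \<bar>t + p\<bar> \<ge> N \<longrightarrow> norm (f (t + p) - f t) \<le> \<epsilon>)"
      if a: "a \<ge> 0" for a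
    proof -
      obtain p where p: "p \<in> {a<..<a + l}" "\<And>t. t \<in> I \<Longrightarrow> t + p \<in> I \<Longrightarrow> \<bar>t\<bar> \<ge> N \<Longrightarrow>
          \<bar>t + p\<bar> \<ge> N \<Longrightarrow> norm (f (t + p) - f t) \<le> \<epsilon>"
        using *[OF a] by meson
      have "norm (f (t + p) - f t) \<le> \<epsilon>" if "t \<ge> N" for t
        using that l(2) p(1) a I by (intro p(2)) auto
      then have "norm (h (t + p) - h t) \<le> \<epsilon>" for t by (rule h_period)
      with p show ?thesis by (intro bexI[of _ p]) auto
    qed
    with l show ?thesis by blast
  qed
  have hAP: "h \<in> AP UNIV"
  proof (rule AP_UNIV_I[OF conth])
    fix \<epsilon> :: real assume "\<epsilon> > 0"
    from common_period[OF this]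
    show "\<exists>l>0. \<forall>a\<ge>0. \<exists>p\<in>{a<..<a + l}. \<forall>t. norm (h (t + p) - h t) \<le> \<epsilon>" by meson
  qed
  have right: "\<exists>T. \<forall>t\<ge>T. norm (f t - h t) \<le> \<epsilon>" if "\<epsilon> > 0" for \<epsilon>
  proof -
    have "\<forall>\<^sub>F k in sequentially. 2 * (1 / 2) ^ k < \<epsilon> / 2"
      using that by (intro order_tendstoD(2)[OF half_lim]) auto
    then obtain k where k: "2 * (1 / 2) ^ k < \<epsilon> / 2"
      by (auto simp: eventually_sequentially)
    have "norm (f t - h t) \<le> \<epsilon>" if "t \<ge> \<sigma> k" for t
    proof -
      \<comment> \<open>The value \<open>g (t - \<sigma> k)\<close> is close to \<open>f t\<close>
        by the first limit and to \<open>h t\<close> by the second.\<close>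
      have "norm (g (t - \<sigma> k) - f t) \<le> 2 * (1 / 2) ^ k"
        using g_bound[of k "t - \<sigma> k"] that by simp
      with h_bound[of t k] k show ?thesis by norm
    qed
    then show ?thesis by blast
  qed
  have "(\<lambda>t. f t - h t) \<in> C_0 I"
  proof (rule C_0I)
    show "(\<lambda>t. f t - h t) \<in> C_b I"
      by (intro C_b_diff fC C_b_mono[OF AP_UNIV_imp_C_b[OF hAP]]) auto
  next
    fix \<epsilon> :: real assume \<epsilon>: "\<epsilon> > 0"
    then obtain T where T: "\<And>t. t \<ge> T \<Longrightarrow> norm (f t - h t) \<le> \<epsilon> / 3"
      using right[of "\<epsilon> / 3"] by auto
    obtain l N where N: "N > 0" and *: "\<And>a. a \<ge> 0 \<Longrightarrow> \<exists>p\<in>{a<..<a + l}.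
      (\<forall>t. norm (h (t + p) - h t) \<le> \<epsilon> / 3) \<and>
      (\<forall>t. t \<in> I \<and> t + p \<in> I \<and> \<bar>t\<bar> \<ge> N \<and> \<bar>t + p\<bar> \<ge> N \<longrightarrow> norm (f (t + p) - f t) \<le> \<epsilon> / 3)"
      using common_period[of "\<epsilon> / 3"] \<epsilon> by (metis zero_less_divide_iff zero_less_numeral)
    have "norm (f t - h t) \<le> \<epsilon>" if t: "t \<in> I" "\<bar>t\<bar> \<ge> max N T" for t
    proof (cases "t \<ge> 0")
      case True
      with t(2) T[of t] \<epsilon> show ?thesis by simp
    next
      case False
      \<comment> \<open>A common period moves \<open>t\<close> from the left end of the line to the right end.\<close>
      with t I have "I = UNIV" by auto
      obtain p where p: "p > - t + max N T" "norm (h (t + p) - h t) \<le> \<epsilon> / 3"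
        "\<bar>t\<bar> \<ge> N \<Longrightarrow> \<bar>t + p\<bar> \<ge> N \<Longrightarrow> norm (f (t + p) - f t) \<le> \<epsilon> / 3"
        using *[of "- t + max N T"] False N \<open>I = UNIV\<close> by fastforce
      have "norm (f (t + p) - f t) \<le> \<epsilon> / 3" using p(1) t N by (intro p(3)) auto
      moreover have "norm (f (t + p) - h (t + p)) \<le> \<epsilon> / 3" using p(1) by (intro T) auto
      ultimately show ?thesis using p(2) by norm
    qed
    then show "\<exists>M. \<forall>t\<in>I. \<bar>t\<bar> \<ge> M \<longrightarrow> norm (f t - h t) \<le> \<epsilon>" by blast
  qed
  with hAP show thesis by (rule that) simp
qed

section \<open>The inclusions between the classes and the theorem\<close>

lemma AAP_subset_AAA:
  assumes "I = UNIV \<or> I = {0..}"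
  shows "(AAP I :: (real \<Rightarrow> 'a::banach) set) \<subseteq> AAA I"
proof
  fix f :: "real \<Rightarrow> 'a" assume f: "f \<in> AAP I"
  then obtain h q where "h \<in> AP UNIV" "q \<in> C_0 I" "\<And>t. t \<in> I \<Longrightarrow> f t = h t + q t"
    using AAP_decomposition[OF assms] by metis
  with f AP_UNIV_subset_AA show "f \<in> AAA I" by (auto simp: AAA_def AAP_def)
qed

lemma AAA_Int_Q_AAP_subset_AAP:
  assumes "{0..} \<subseteq> I"
  shows "AAA I \<inter> Q_AAP I \<subseteq> AAP I"
proof
  fix f :: "real \<Rightarrow> 'a" assume f: "f \<in> AAA I \<inter> Q_AAP I"
  then obtain h q where hq: "h \<in> AA" "q \<in> C_0 I" "\<And>t. t \<in> I \<Longrightarrow> f t = h t + q t"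
    by (auto simp: AAA_def)
  with f assms have "h \<in> AP UNIV" by (blast intro: AA_part_of_Q_AAP)
  with f hq show "f \<in> AAP I" by (auto simp: AAA_def intro: AP_plus_C_0_imp_AAP)
qed

lemma AA_Int_Q_AAP_subset_AP: "AA \<inter> Q_AAP UNIV \<subseteq> AP UNIV"
proof
  fix f :: "real \<Rightarrow> 'a" assume "f \<in> AA \<inter> Q_AAP UNIV"
  \<comment> \<open>Here \<open>f\<close> is its own almost automorphic part, with zero
    remainder.\<close>
  then show "f \<in> AP UNIV"
    by (intro AA_part_of_Q_AAP[of UNIV f f "\<lambda>_. 0"] zero_in_C_0) auto
qed

lemma AP_UNIV_subset_AAP: "AP UNIV \<subseteq> AAP UNIV"
proof
  fix f :: "real \<Rightarrow> 'a" assume "f \<in> AP UNIV"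
  then show "f \<in> AAP UNIV"
    by (intro AP_plus_C_0_imp_AAP[of f UNIV f "\<lambda>_. 0"] zero_in_C_0 AP_UNIV_imp_C_b) auto
qed

theorem theorem2p5:
  assumes nontrivial: "\<exists>x :: 'a::complex_banach. x \<noteq> 0"
  shows "(\<forall>I :: real set. I = UNIV \<or> I = {0..} \<longrightarrow>
            AAA I \<inter> Q_AAP I = (AAP I :: (real \<Rightarrow> 'a) set) \<and>
            ((AAA I :: (real \<Rightarrow> 'a) set) - AAP I) \<inter> Q_AAP I = {}) \<and>
         AA \<inter> Q_AAP UNIV = (AP UNIV :: (real \<Rightarrow> 'a) set)"
proof -
  have "AAA I \<inter> Q_AAP I = (AAP I :: (real \<Rightarrow> 'a) set)" if I: "I = UNIV \<or> I = {0..}" for I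
  proof -
    have "{0..} \<subseteq> I" using I by auto
    then show ?thesis
      using AAA_Int_Q_AAP_subset_AAP AAP_subset_AAA[OF I] AAP_subset_Q_AAP[OF I] by blast
  qed
  moreover have "AA \<inter> Q_AAP UNIV = (AP UNIV :: (real \<Rightarrow> 'a) set)"
    \<comment> \<open>Almost periodic functions reach \<open>Q_AAP UNIV\<close> through
      \<open>AAP UNIV\<close>.\<close>
    using AA_Int_Q_AAP_subset_AP AP_UNIV_subset_AA AP_UNIV_subset_AAP
      AAP_subset_Q_AAP[of UNIV] by blast
  \<comment> \<open>The emptiness claim is set algebra from the first equality.\<close>
  ultimately show ?thesis by blast
qed

end
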